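(* Let $\mathbb{F}_q$ be a finite field with $q$ elements and let $L$ be a finite-dimensional non-abelian Lie algebra over $\mathbb{F}_q$. Then $$d(L)\leq \frac{q^{2}+q-1}{q^{3}}.$$
   Context: For a finite-dimensional Lie algebra $L$ over the finite field $\mathbb{F}_q$ (so $L$ is a finite set), the commutativity degree of $L$ is $d(L)=\dfrac{|\{(x,y)\in L\times L \mid [x,y]=0\}|}{|L|^{2}}$. *)

theory Defs
  imports Complex_Main
begin

locale lie_algebra = vector_space scale
  for scale :: "'k::field \<Rightarrow> 'l::ab_group_add \<Rightarrow> 'l" +
  fixes bracket :: "'l \<Rightarrow> 'l \<Rightarrow> 'l"
  assumes linear_left: "Vector_Spaces.linear scale scale (\<lambda>x. bracket x y)"
    and linear_right: "Vector_Spaces.linear scale scale (\<lambda>y. bracket x y)"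
    and alternating: "bracket x x = 0"
    and jacobi: "bracket x (bracket y z) + bracket y (bracket z x) + bracket z (bracket x y) = 0"

text \<open>The library locale \<^locale>\<open>finite_dimensional_vector_space\<close> carries a
  chosen finite basis as a parameter; finite-dimensionality as a property asserts that
  such a basis exists.\<close>

definition finite_dimensional :: "('k::field \<Rightarrow> 'l::ab_group_add \<Rightarrow> 'l) \<Rightarrow> bool" where
  "finite_dimensional scale \<longleftrightarrow> (\<exists>B. finite_dimensional_vector_space scale B)"

definition abelian :: "('l \<Rightarrow> 'l \<Rightarrow> 'l::zero) \<Rightarrow> bool" where
  "abelian bracket \<longleftrightarrow> (\<forall>x y. bracket x y = 0)"

text \<open>Meaningful only when the type \<open>'l\<close> is finite: otherwise \<^const>\<open>card\<close> is \<open>0\<close>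
  and the quotient is \<open>0\<close> by convention. A finite-dimensional space over a finite
  field is finite.\<close>

definition commutativity_degree :: "('l \<Rightarrow> 'l \<Rightarrow> 'l::zero) \<Rightarrow> real" where
  "commutativity_degree bracket =
     real (card {(x, y). bracket x y = 0}) / (real (card (UNIV :: 'l set)))\<^sup>2"

end

theory Submission
  imports Defs
begin

text \<open>A centralizer of a non-central element is a proper subspace, and the center \<open>Z\<close> is a
  proper subspace of it; since a proper subspace has index at least \<open>q\<close>, this gives
  \<open>\<bar>C x\<bar> \<le> \<bar>L\<bar> / q\<close> and \<open>\<bar>Z\<bar> \<le> \<bar>L\<bar> / q\<^sup>2\<close>. The number of commuting pairs is the sum of the
  \<open>\<bar>C x\<bar>\<close>, hence at most \<open>\<bar>Z\<bar> \<bar>L\<bar> + (\<bar>L\<bar> - \<bar>Z\<bar>) \<bar>L\<bar> / q\<close>, which increases with \<open>\<bar>Z\<bar>\<close>.\<close>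

text \<open>The translates of \<open>W\<close> by the multiples of \<open>v\<close> are pairwise
  disjoint and all lie in \<open>U\<close>. There is one for each scalar.\<close>

lemma (in vector_space) card_proper_subspace_le:
  assumes W: "subspace W" and U: "subspace U" "finite U"
    and WU: "W \<subseteq> U" and v: "v \<in> U" "v \<notin> W"
  shows "card W * card (UNIV :: 'a set) \<le> card U"
proof -
  let ?f = "\<lambda>(w, c). w + scale c v"
  have "inj_on ?f (W \<times> UNIV)"
  proof (rule inj_onI, clarify)
    fix w c w' c'
    assume w: "w \<in> W" "w' \<in> W" and eq: "w + scale c v = w' + scale c' v"
    have diff: "scale (c - c') v = w' - w"
      using eq by (simp add: scale_left_diff_distrib algebra_simps)
    have "c = c'"
    proof (rule ccontr)
      assume "c \<noteq> c'"
      \<comment> \<open>Two distinct scalars with the same image would allow solving for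
        \<open>v\<close> inside \<open>W\<close>.\<close>
      then have "v = scale (inverse (c - c')) (w' - w)"
        unfolding diff[symmetric] by simp
      also have "\<dots> \<in> W" using W w by (intro subspace_scale subspace_diff)
      finally show False using v by simp
    qed
    with eq show "w = w' \<and> c = c'" by simp
  qed
  moreover have "?f ` (W \<times> UNIV) \<subseteq> U"
    using WU v U by (auto intro!: subspace_add subspace_scale)
  ultimately have "card (W \<times> (UNIV :: 'a set)) \<le> card U"
    using U(2) by (rule card_inj_on_le)
  then show ?thesis by (simp add: card_cartesian_product)
qed

context lie_algebra
begin

definition centralizer :: "'l \<Rightarrow> 'l set" where
  "centralizer x = {y. bracket x y = 0}"

definition center :: "'l set" where
  "center = {x. \<forall>y. bracket x y = 0}"

lemma module_hom_bracket:
  "module_hom scale scale (\<lambda>x. bracket x y)" "module_hom scale scale (\<lambda>y. bracket x y)"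
  using linear_left linear_right by (simp_all add: Vector_Spaces.linear_def)

text \<open>Polarization of \<open>alternating\<close> at \<open>x + y\<close>. It reconciles
  \<open>center\<close>, which constrains the left argument, with \<open>centralizer\<close>, which
  constrains the right one.\<close>

lemma bracket_antisym: "bracket y x = - bracket x y"
proof -
  have "bracket (x + y) (x + y) = bracket x x + bracket y x + (bracket x y + bracket y y)"
    by (simp only: module_hom.add[OF module_hom_bracket(1)] module_hom.add[OF module_hom_bracket(2)])
  then have "bracket y x + bracket x y = 0" by (simp add: alternating)
  then show ?thesis by (simp only: eq_neg_iff_add_eq_0)
qed

lemma subspace_centralizer: "subspace (centralizer x)"
  unfolding centralizer_def by (rule module_hom.subspace_kernel[OF module_hom_bracket(2)])

lemma subspace_center: "subspace center"
proof -
  have "center = (\<Inter>y. {x. bracket x y = 0})" by (auto simp: center_def)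
  then show ?thesis
    using module_hom.subspace_kernel[OF module_hom_bracket(1)] by (auto intro!: subspace_Inter)
qed

lemma card_centralizer_le:
  assumes "finite (UNIV :: 'l set)" "x \<notin> center"
  shows "card (centralizer x) * card (UNIV :: 'k set) \<le> card (UNIV :: 'l set)"
proof -
  obtain y where "y \<notin> centralizer x" using assms by (auto simp: center_def centralizer_def)
  then show ?thesis
    using assms by (intro card_proper_subspace_le subspace_centralizer subspace_UNIV) auto
qed

lemma card_center_le:
  assumes fin: "finite (UNIV :: 'l set)" and "\<not> abelian bracket"
  shows "card center * (card (UNIV :: 'k set))\<^sup>2 \<le> card (UNIV :: 'l set)"
proof -
  obtain x where x: "x \<notin> center" using assms by (auto simp: abelian_def center_def)
  have "center \<subseteq> centralizer x"
  proof
    fix z assume "z \<in> center"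
    then show "z \<in> centralizer x"
      using bracket_antisym[of x z] by (simp add: center_def centralizer_def)
  qed
  \<comment> \<open>The vector \<open>x\<close> itself shows that \<open>center\<close> is strictly
    smaller than \<open>centralizer x\<close>.\<close>
  moreover have "x \<in> centralizer x" by (simp add: centralizer_def alternating)
  ultimately have "card center * card (UNIV :: 'k set) \<le> card (centralizer x)"
    using x finite_subset[OF subset_UNIV fin]
    by (intro card_proper_subspace_le subspace_center subspace_centralizer)
  then have "card center * card (UNIV :: 'k set) * card (UNIV :: 'k set)
      \<le> card (centralizer x) * card (UNIV :: 'k set)"
    by (rule mult_right_mono) simp
  also have "\<dots> \<le> card (UNIV :: 'l set)" using fin x by (rule card_centralizer_le)
  finally show ?thesis by (simp add: power2_eq_square mult.assoc)
qed

lemma card_commuting_pairs: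
  assumes "finite (UNIV :: 'l set)"
  shows "card {(x, y). bracket x y = 0} = (\<Sum>x\<in>UNIV. card (centralizer x))"
proof -
  have "{(x, y). bracket x y = 0} = (SIGMA x:UNIV. centralizer x)"
    by (auto simp: centralizer_def)
  then show ?thesis
    using assms by (simp add: card_SigmaI finite_subset[OF subset_UNIV])
qed

text \<open>The bound is stated over the reals so that neither the difference nor the quotient is
  truncated. The size of the center stays as a parameter, to be estimated afterwards.\<close>

lemma card_commuting_pairs_le:
  assumes fin: "finite (UNIV :: 'l set)" and fink: "finite (UNIV :: 'k set)"
  defines "q \<equiv> real (card (UNIV :: 'k set))" and "n \<equiv> real (card (UNIV :: 'l set))"
  shows "real (card {(x, y). bracket x y = 0})
    \<le> real (card center) * n + (n - real (card center)) * (n / q)"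
proof -
  have q: "q > 0" using fink by (simp add: q_def card_gt_0_iff)
  have fins: "finite (A :: 'l set)" for A using fin by (rule finite_subset[OF subset_UNIV])
  have "real (card {(x, y). bracket x y = 0}) = (\<Sum>x\<in>UNIV. real (card (centralizer x)))"
    using card_commuting_pairs[OF fin] by simp
  also have "\<dots> = (\<Sum>x\<in>center. real (card (centralizer x)))
      + (\<Sum>x\<in>-center. real (card (centralizer x)))"
    using sum.subset_diff[of center UNIV] fins by (simp add: Compl_eq_Diff_UNIV add.commute)
  \<comment> \<open>Nothing is lost here: a central element has the whole algebra as its
    centralizer.\<close>
  also have "(\<Sum>x\<in>center. real (card (centralizer x))) \<le> (\<Sum>x\<in>center. n)"
    using fin by (intro sum_mono) (simp add: n_def card_mono)
  also have "(\<Sum>x\<in>-center. real (card (centralizer x))) \<le> (\<Sum>x\<in>-center. n / q)"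
  proof (rule sum_mono)
    fix x assume "x \<in> - center"
    then have "real (card (centralizer x) * card (UNIV :: 'k set)) \<le> n"
      using card_centralizer_le[OF fin, of x] unfolding n_def by (simp only: of_nat_le_iff) simp
    then show "real (card (centralizer x)) \<le> n / q" using q by (simp add: q_def field_simps)
  qed
  also have "(\<Sum>x\<in>center. n) + (\<Sum>x\<in>-center. n / q)
      = real (card center) * n + (n - real (card center)) * (n / q)"
    using fin fins by (simp add: n_def card_Diff_subset Compl_eq_Diff_UNIV of_nat_diff card_mono)
  finally show ?thesis by simp
qed

end

theorem corollary4p3:
  fixes scale :: "'k::{field,finite} \<Rightarrow> 'l::ab_group_add \<Rightarrow> 'l"
    and bracket :: "'l \<Rightarrow> 'l \<Rightarrow> 'l"
    and q :: nat
  assumes "q = card (UNIV :: 'k set)"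
    and "lie_algebra scale bracket"
    and "finite_dimensional scale"
    and "\<not> abelian bracket"
  shows "commutativity_degree bracket \<le> ((real q)\<^sup>2 + real q - 1) / (real q) ^ 3"
proof -
  interpret lie_algebra scale bracket by fact
  define n where "n = real (card (UNIV :: 'l set))"
  define z where "z = real (card center)"
  have q: "real q \<ge> 1" using assms(1) by (simp add: Suc_le_eq card_gt_0_iff)
  show ?thesis
  proof (cases "finite (UNIV :: 'l set)")
    case False
    \<comment> \<open>This case cannot occur, but here \<open>card UNIV = 0\<close> makes the degree \<open>0\<close> by convention.\<close>
    moreover have "0 \<le> ((real q)\<^sup>2 + real q - 1) / (real q) ^ 3"
      using q by (intro divide_nonneg_nonneg) (simp_all add: add_increasing)
    ultimately show ?thesis by (simp add: commutativity_degree_def)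
  next
    case True
    have n: "n > 0" using True by (simp add: n_def card_gt_0_iff)
    have "real (card center * q\<^sup>2) \<le> n"
      using card_center_le[OF True assms(4)] assms(1) unfolding n_def by (simp only: of_nat_le_iff)
    then have z: "z \<le> n / (real q)\<^sup>2" using q by (simp add: z_def field_simps)
    have "real (card {(x, y). bracket x y = 0}) \<le> z * n + (n - z) * (n / real q)"
      using card_commuting_pairs_le[OF True] assms(1) by (simp add: n_def z_def)
    \<comment> \<open>Regrouped as an affine function of \<open>z\<close>, whose slope is
      nonnegative because \<open>q\<close> is at least 1. Hence \<open>z\<close> may be replaced by
      its upper bound.\<close>
    also have "\<dots> = z * (n * (1 - 1 / real q)) + n\<^sup>2 / real q"
      by (simp add: algebra_simps diff_divide_distrib power2_eq_square)
    also have "\<dots> \<le> n / (real q)\<^sup>2 * (n * (1 - 1 / real q)) + n\<^sup>2 / real q"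
      using z n q by (intro add_right_mono mult_right_mono) simp_all
    \<comment> \<open>After factoring out the square of \<open>n\<close>, what remains is 1/q^2 -
      1/q^3 + 1/q.\<close>
    also have "\<dots> = ((real q)\<^sup>2 + real q - 1) / (real q) ^ 3 * n\<^sup>2"
      using q by (simp add: field_simps power2_eq_square power3_eq_cube)
    finally show ?thesis
      using n by (simp add: commutativity_degree_def n_def[symmetric] pos_divide_le_eq)
  qed
qed

end
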